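(* For any given $\beta>0$ there exists a map $x_t\mapsto \hat{x}_0(x_t)$ such that the score function of the diffused product distribution can be written as $$\nabla_{x_t}\log \tilde{p}_t(x_t|\rho) = \nabla_{x_t}\log p_t(x_t|\rho) - \beta\, \nabla_{x_t} f\big(\hat{x}_0(x_t)\big),$$ where $\nabla_{x_t}\log p_t(x_t|\rho)$ is the score function of the diffused data distribution, and $\hat{x}_0(x_t)$ satisfies $$f(\hat{x}_0(x_t)) = -\frac{1}{\beta}\log\Big(\int p_{t0}(x_0|x_t,\rho)\,B_{\beta}(x_0)\,dx_0\Big).$$ Here $\nabla_{x_t} f(\hat x_0(x_t))$ denotes the gradient with respect to $x_t$ of the composite function $x_t\mapsto f(\hat x_0(x_t))$.
   Context: Let $f:\mathbb{R}^n\to\mathbb{R}$ be a differentiable objective function, $\rho\in(0,1)$, and $B_\beta(x)=e^{-\beta f(x)}$ the (unnormalized) Boltzmann distribution associated with $f$. Let $p_0(x_0|\rho)$ be the data distribution on $\mathbb{R}^n$ (the empirical distribution, conditional on $\rho$, of a given finite data set $\{(x^{(i)},\rho^{(i)})\}_{i=1}^N$). The product distribution is $\tilde p_0(x_0|\rho)\propto p_0(x_0|\rho)B_\beta(x_0)$. Consider the forward SDE $dx_t=a(x_t,t)\,dt+b(t)\,dB_t$, $t\in[0,T]$, where $B_t$ is a standard Brownian motion, $a(\cdot,t):\mathbb{R}^n\to\mathbb{R}^n$ is the drift coefficient and $b(\cdot):\mathbb{R}\to\mathbb{R}$ is the diffusion coefficient; let $p_{0t}(x_t|x_0)$ be its transition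 kernel. The diffused data distribution and diffused product distribution are $$p_t(x_t|\rho)=\int p_{0t}(x_t|x_0)p_0(x_0|\rho)\,dx_0,\qquad \tilde p_t(x_t|\rho)=\int p_{0t}(x_t|x_0)\tilde p_0(x_0|\rho)\,dx_0 .$$ The posterior is $p_{t0}(x_0|x_t,\rho)=p_{0t}(x_t|x_0)p_0(x_0|\rho)/p_t(x_t|\rho)$. The score function of a density $q$ is $\nabla\log q$. (Integrals against $p_0(x_0|\rho)\,dx_0$ are understood as integrals against the corresponding measure.) *)

theory Defs
  imports "HOL-Probability.Probability"
begin

text \<open>The gradient is meaningful only at points of differentiability, and the score of a
  density \<open>q\<close> only where in addition \<open>q x > 0\<close>; statements using them should assert both.\<close>

definition gradient :: "('a::euclidean_space \<Rightarrow> real) \<Rightarrow> 'a \<Rightarrow> 'a" where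
  "gradient g x = (THE D. GDERIV g x :> D)"

definition score :: "('a::euclidean_space \<Rightarrow> real) \<Rightarrow> 'a \<Rightarrow> 'a" where
  "score q = gradient (\<lambda>x. ln (q x))"

text \<open>Standard \<open>n\<close>-dimensional Brownian motion with respect to the filtration \<open>F\<close>. The increment
  over \<open>[s, t]\<close> has the product of the \<open>N(0, t - s)\<close> densities as its density, i.e. it is centred
  Gaussian with covariance \<open>(t - s)\<close> times the identity.\<close>

definition brownian_motion ::
  "'w measure \<Rightarrow> (real \<Rightarrow> 'w measure) \<Rightarrow> (real \<Rightarrow> 'w \<Rightarrow> real ^ 'n) \<Rightarrow> bool" where
  "brownian_motion M F B \<longleftrightarrow>
     prob_space M \<and>
     filtration (space M) F \<and> (\<forall>t\<ge>0. subalgebra M (F t)) \<and>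
     (\<forall>t\<ge>0. B t \<in> borel_measurable (F t)) \<and>
     (AE \<omega> in M. B 0 \<omega> = 0) \<and>
     (AE \<omega> in M. continuous_on {0..} (\<lambda>t. B t \<omega>)) \<and>
     (\<forall>s t. 0 \<le> s \<and> s < t \<longrightarrow>
        prob_space.indep_set M (sets (F s))
          {(\<lambda>\<omega>. B t \<omega> - B s \<omega>) -` A \<inter> space M | A. A \<in> sets borel} \<and>
        distributed M lborel (\<lambda>\<omega>. B t \<omega> - B s \<omega>)
          (\<lambda>x. ennreal (\<Prod>i\<in>UNIV. normal_density 0 (sqrt (t - s)) (x $ i))))"

text \<open>The step function with value \<open>c j\<close> on \<open>(s j, s (j + 1)]\<close> for \<open>j < m\<close>, and its stochastic
  integral with respect to \<open>B\<close>.\<close>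

definition step_fun :: "nat \<Rightarrow> (nat \<Rightarrow> real) \<Rightarrow> (nat \<Rightarrow> real) \<Rightarrow> real \<Rightarrow> real" where
  "step_fun m s c u = (\<Sum>j<m. c j * indicator {s j<..s (Suc j)} u)"

definition step_integral ::
  "(real \<Rightarrow> 'w \<Rightarrow> real ^ 'n) \<Rightarrow> nat \<Rightarrow> (nat \<Rightarrow> real) \<Rightarrow> (nat \<Rightarrow> real) \<Rightarrow> 'w \<Rightarrow> real ^ 'n" where
  "step_integral B m s c \<omega> = (\<Sum>j<m. c j *\<^sub>R (B (s (Suc j)) \<omega> - B (s j) \<omega>))"

text \<open>\<open>J\<close> is (a version of) the stochastic integral of the deterministic integrand \<open>b\<close> over
  \<open>[0, t]\<close>: the \<open>L\<^sup>2\<close> limit of the integrals of step functions approximating \<open>b\<close> in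
  \<open>L\<^sup>2[0, t]\<close>.\<close>

definition has_stochastic_integral ::
  "'w measure \<Rightarrow> (real \<Rightarrow> 'w \<Rightarrow> real ^ 'n) \<Rightarrow> (real \<Rightarrow> real) \<Rightarrow> real \<Rightarrow> ('w \<Rightarrow> real ^ 'n) \<Rightarrow> bool" where
  "has_stochastic_integral M B b t J \<longleftrightarrow>
     set_borel_measurable borel {0..t} b \<and> J \<in> borel_measurable M \<and>
     (\<exists>m s c.
        (\<forall>k. s k 0 = 0 \<and> s k (m k) = t \<and> (\<forall>j<m k. s k j \<le> s k (Suc j))) \<and>
        (\<lambda>k. \<integral>\<^sup>+ u \<in> {0..t}. ennreal ((b u - step_fun (m k) (s k) (c k) u)\<^sup>2) \<partial>lborel)
          \<longlonglongrightarrow> 0 \<and>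
        (\<lambda>k. \<integral>\<^sup>+ \<omega>. ennreal ((norm (J \<omega> - step_integral B (m k) (s k) (c k) \<omega>))\<^sup>2) \<partial>M)
          \<longlonglongrightarrow> 0)"

definition sde_solution ::
  "'w measure \<Rightarrow> (real \<Rightarrow> 'w measure) \<Rightarrow> (real \<Rightarrow> 'w \<Rightarrow> real ^ 'n) \<Rightarrow>
   (real ^ 'n \<Rightarrow> real \<Rightarrow> real ^ 'n) \<Rightarrow> (real \<Rightarrow> real) \<Rightarrow> real \<Rightarrow> real ^ 'n \<Rightarrow>
   (real \<Rightarrow> 'w \<Rightarrow> real ^ 'n) \<Rightarrow> bool" where
  "sde_solution M F B a b T x0 X \<longleftrightarrow>
     (\<forall>t\<in>{0..T}. X t \<in> borel_measurable (F t)) \<and>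
     (AE \<omega> in M. continuous_on {0..T} (\<lambda>t. X t \<omega>)) \<and>
     (\<forall>t\<in>{0..T}. \<exists>J. has_stochastic_integral M B b t J \<and>
        (AE \<omega> in M. set_integrable lborel {0..t} (\<lambda>s. a (X s \<omega>) s) \<and>
           X t \<omega> = x0 + (LINT s:{0..t}|lborel. a (X s \<omega>) s) + J \<omega>))"

text \<open>\<open>p x0\<close> is a density of the state at time \<open>t\<close> of the solution started at \<open>x0\<close> at time 0.
  For \<open>t = 0\<close> no such \<open>p\<close> exists, since the law of the state is then a Dirac measure.\<close>

definition transition_density ::
  "'w measure \<Rightarrow> (real \<Rightarrow> 'w measure) \<Rightarrow> (real \<Rightarrow> 'w \<Rightarrow> real ^ 'n) \<Rightarrow>
   (real ^ 'n \<Rightarrow> real \<Rightarrow> real ^ 'n) \<Rightarrow> (real \<Rightarrow> real) \<Rightarrow> real \<Rightarrow> real \<Rightarrow>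
   (real ^ 'n \<Rightarrow> real ^ 'n \<Rightarrow> real) \<Rightarrow> bool" where
  "transition_density M F B a b T t p \<longleftrightarrow>
     (\<exists>X. (\<forall>x0. sde_solution M F B a b T x0 (X x0)) \<and>
          (\<forall>x0. (\<forall>x. 0 \<le> p x0 x) \<and>
                distributed M lborel (X x0 t) (\<lambda>x. ennreal (p x0 x))))"

text \<open>The joint empirical distribution of the pairs \<open>D 1, \<dots>, D N\<close>, conditioned on the second
  component being \<open>\<rho>\<close>, projected to the first component. \<open>cond_pmf\<close> requires that \<open>\<rho>\<close> occurs
  in the data.\<close>

definition data_dist :: "nat \<Rightarrow> (nat \<Rightarrow> 'a \<times> real) \<Rightarrow> real \<Rightarrow> 'a measure" where
  "data_dist N D \<rho> =
     measure_pmf (map_pmf fst (cond_pmf (map_pmf D (pmf_of_set {1..N})) (UNIV \<times> {\<rho>})))"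

definition boltzmann :: "real \<Rightarrow> ('a \<Rightarrow> real) \<Rightarrow> 'a \<Rightarrow> real" where
  "boltzmann \<beta> f x = exp (- \<beta> * f x)"

definition product_dist :: "'a measure \<Rightarrow> real \<Rightarrow> ('a \<Rightarrow> real) \<Rightarrow> 'a measure" where
  "product_dist P0 \<beta> f =
     density P0 (\<lambda>x. ennreal (boltzmann \<beta> f x / (\<integral>y. boltzmann \<beta> f y \<partial>P0)))"

definition diffused :: "('a \<Rightarrow> 'a \<Rightarrow> real) \<Rightarrow> 'a measure \<Rightarrow> 'a \<Rightarrow> real" where
  "diffused p0t P0 x = (\<integral>x0. p0t x0 x \<partial>P0)"

definition posterior :: "('a \<Rightarrow> 'a \<Rightarrow> real) \<Rightarrow> 'a measure \<Rightarrow> 'a \<Rightarrow> 'a measure" where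
  "posterior p0t P0 x = density P0 (\<lambda>x0. ennreal (p0t x0 x / diffused p0t P0 x))"

end

theory Submission
  imports Defs
begin

text \<open>
  Write \<open>Z\<close> for the normalising constant of the product distribution. The posterior mean of
  \<open>boltzmann \<beta> f\<close> equals \<open>Z * pt_prod x / pt x\<close> wherever \<open>pt x > 0\<close>. Since the data
  distribution has finite support, this mean is a finite weighted average of values
  \<open>exp (- \<beta> * f x\<^sub>i)\<close>, so \<open>- ln (\<dots>) / \<beta>\<close> lies between two values of \<open>f\<close>, and the intermediate
  value theorem provides a point \<open>xhat x\<close> where \<open>f\<close> attains it. Taking the gradient of
  \<open>- \<beta> * f (xhat y) = ln Z + ln (pt_prod y) - ln (pt y)\<close>, valid near \<open>x\<close>, yields the formula.
\<close>

text \<open>Riesz representation: the derivative is a linear functional, and its adjoint applied to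
  \<open>1\<close> is the vector representing it.\<close>

lemma differentiable_imp_GDERIV:
  fixes g :: "'a::euclidean_space \<Rightarrow> real"
  assumes "g differentiable at x"
  obtains G where "GDERIV g x :> G"
proof -
  from assms obtain g' where g': "(g has_derivative g') (at x)"
    unfolding differentiable_def by blast
  then have lin: "linear g'"
    by (rule has_derivative_linear)
  have "g' = (\<lambda>h. inner h (adjoint g' 1))"
    using adjoint_works[OF lin, where y = 1] by (simp add: fun_eq_iff)
  with g' have "GDERIV g x :> adjoint g' 1"
    unfolding gderiv_def by simp
  then show thesis by (rule that)
qed

lemma gradient_eqI:
  fixes g :: "'a::euclidean_space \<Rightarrow> real"
  assumes "GDERIV g x :> G"
  shows "gradient g x = G"
  unfolding gradient_def
proof (rule the_equality[where P = "\<lambda>D. GDERIV g x :> D", OF assms])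
  fix G' assume "GDERIV g x :> G'"
  with assms have "(\<lambda>h. inner h G') = (\<lambda>h. inner h G)"
    unfolding gderiv_def by (rule has_derivative_unique[rotated])
  then show "G' = G"
    by (metis vector_eq_ldot inner_commute)
qed

lemma diffused_measure_pmf:
  assumes "finite (set_pmf p)"
  shows "diffused k (measure_pmf p) x = (\<Sum>z\<in>set_pmf p. pmf p z * k z x)"
  unfolding diffused_def
  by (subst integral_measure_pmf_real[OF assms]) (auto simp: mult.commute)

lemma boltzmann_pos: "0 < boltzmann \<beta> f x"
  by (simp add: boltzmann_def)

lemma integral_boltzmann_pmf_pos:
  assumes "finite (set_pmf p)"
  shows "0 < (\<integral>z. boltzmann \<beta> f z \<partial>measure_pmf p)"
  by (subst integral_measure_pmf_real[OF assms])
     (auto simp: set_pmf_not_empty assms boltzmann_pos pmf_positive intro!: sum_pos)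

lemma diffused_product_dist_pmf:
  assumes fin: "finite (set_pmf p)"
  shows "diffused k (product_dist (measure_pmf p) \<beta> f) x =
    (\<Sum>z\<in>set_pmf p. pmf p z * boltzmann \<beta> f z * k z x) / (\<integral>z. boltzmann \<beta> f z \<partial>measure_pmf p)"
    (is "_ = _ / ?Z")
proof -
  have "diffused k (product_dist (measure_pmf p) \<beta> f) x =
      (\<integral>z. (boltzmann \<beta> f z / ?Z) * k z x \<partial>measure_pmf p)"
    unfolding diffused_def product_dist_def
    by (subst integral_density)
       (use integral_boltzmann_pmf_pos[OF fin, of \<beta> f] in
         \<open>auto intro!: AE_I2 divide_nonneg_nonneg less_imp_le[OF boltzmann_pos]\<close>)
  also have "\<dots> = (\<Sum>z\<in>set_pmf p. (boltzmann \<beta> f z / ?Z) * k z x * pmf p z)"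
    by (subst integral_measure_pmf_real[OF fin]) auto
  also have "\<dots> = (\<Sum>z\<in>set_pmf p. pmf p z * boltzmann \<beta> f z * k z x) / ?Z"
    by (subst sum_divide_distrib) (auto intro!: sum.cong)
  finally show ?thesis .
qed

text \<open>Points where \<open>diffused\<close> vanishes are covered too: division by zero then
  makes both sides 0.\<close>

lemma integral_posterior_pmf:
  fixes g :: "'a \<Rightarrow> real"
  assumes fin: "finite (set_pmf p)" and k: "\<And>z. 0 \<le> k z x"
  shows "(\<integral>z. g z \<partial>posterior k (measure_pmf p) x) =
    (\<Sum>z\<in>set_pmf p. pmf p z * g z * k z x) / diffused k (measure_pmf p) x"
proof -
  let ?d = "diffused k (measure_pmf p) x"
  have d: "0 \<le> ?d"
    unfolding diffused_def by (simp add: k)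
  have "(\<integral>z. g z \<partial>posterior k (measure_pmf p) x) = (\<integral>z. (k z x / ?d) * g z \<partial>measure_pmf p)"
    unfolding posterior_def
    by (subst integral_density) (auto intro!: AE_I2 divide_nonneg_nonneg k d)
  also have "\<dots> = (\<Sum>z\<in>set_pmf p. (k z x / ?d) * g z * pmf p z)"
    by (subst integral_measure_pmf_real[OF fin]) auto
  also have "\<dots> = (\<Sum>z\<in>set_pmf p. pmf p z * g z * k z x) / ?d"
    by (subst sum_divide_distrib) (auto intro!: sum.cong)
  finally show ?thesis .
qed

text \<open>The average lies between the extreme values of \<open>h\<close> on \<open>S\<close>.
  Both are attained, and the range of \<open>h\<close> is connected as a continuous image of the
  whole space, so it contains everything in between.\<close>

lemma weighted_average_in_range:
  fixes h :: "'a::real_normed_vector \<Rightarrow> real"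
  assumes cont: "continuous_on UNIV h" and fin: "finite S"
    and w: "\<And>z. z \<in> S \<Longrightarrow> 0 \<le> w z" and pos: "0 < sum w S"
  obtains y where "h y = (\<Sum>z\<in>S. w z * h z) / sum w S"
proof -
  let ?A = "(\<Sum>z\<in>S. w z * h z) / sum w S"
  \<comment> \<open>Positive total weight rules out an empty \<open>S\<close>, so minimum and
    maximum exist.\<close>
  have ne: "h ` S \<noteq> {}" and fin': "finite (h ` S)"
    using pos fin by auto
  from Min_in[OF fin' ne] obtain u where u: "h u = Min (h ` S)" by auto
  from Max_in[OF fin' ne] obtain v where v: "h v = Max (h ` S)" by auto
  have "(\<Sum>z\<in>S. w z * h u) \<le> (\<Sum>z\<in>S. w z * h z)"
    using fin' by (intro sum_mono mult_left_mono w) (auto simp: u)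
  then have "h u \<le> ?A"
    using pos by (simp add: pos_le_divide_eq sum_distrib_left mult.commute)
  moreover have "(\<Sum>z\<in>S. w z * h z) \<le> (\<Sum>z\<in>S. w z * h v)"
    using fin' by (intro sum_mono mult_left_mono w) (auto simp: v)
  then have "?A \<le> h v"
    using pos by (simp add: pos_divide_le_eq sum_distrib_left mult.commute)
  moreover have "connected (range h)"
    by (intro connected_continuous_image cont connected_UNIV)
  ultimately have "?A \<in> range h"
    by (meson connectedD_interval rangeI)
  then show thesis using that by (metis imageE)
qed

text \<open>The analytic core, for an abstract nonnegative kernel. The map \<open>xhat\<close> is
  chosen pointwise and may be irregular; the composite of \<open>f\<close> with it is differentiable
  because it has a closed form in \<open>pt\<close> and \<open>pt_prod\<close>.\<close>

lemma score_diffused_product_pmf: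
  fixes f :: "'a::euclidean_space \<Rightarrow> real" and k :: "'a \<Rightarrow> 'a \<Rightarrow> real"
  assumes fin: "finite (set_pmf p)" and f: "continuous_on UNIV f"
    and k: "\<And>z x. 0 \<le> k z x" and k_diff: "\<And>z. k z differentiable_on UNIV"
    and \<beta>: "\<beta> > 0"
  defines "pt \<equiv> diffused k (measure_pmf p)"
    and "pt_prod \<equiv> diffused k (product_dist (measure_pmf p) \<beta> f)"
  shows "\<exists>xhat. \<forall>x. pt x > 0 \<longrightarrow>
    f (xhat x) = - (1 / \<beta>) * ln (\<integral>z. boltzmann \<beta> f z \<partial>posterior k (measure_pmf p) x) \<and>
    pt_prod x > 0 \<and>
    (\<lambda>y. ln (pt_prod y)) differentiable at x \<and>
    (\<lambda>y. ln (pt y)) differentiable at x \<and>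
    (\<lambda>y. f (xhat y)) differentiable at x \<and>
    score pt_prod x = score pt x - \<beta> *\<^sub>R gradient (\<lambda>y. f (xhat y)) x"
proof -
  define S where "S = set_pmf p"
  define Z where "Z = (\<integral>z. boltzmann \<beta> f z \<partial>measure_pmf p)"
  define I where "I x = (\<integral>z. boltzmann \<beta> f z \<partial>posterior k (measure_pmf p) x)" for x
  have finS: "finite S" and Z: "Z > 0"
    using fin integral_boltzmann_pmf_pos[OF fin] by (auto simp: S_def Z_def)
  have pt_eq: "pt x = (\<Sum>z\<in>S. pmf p z * k z x)" for x
    unfolding pt_def S_def by (rule diffused_measure_pmf[OF fin])
  have prod_eq: "pt_prod x = (\<Sum>z\<in>S. pmf p z * boltzmann \<beta> f z * k z x) / Z" for x
    unfolding pt_prod_def S_def Z_def by (rule diffused_product_dist_pmf[OF fin])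
  have I_eq: "I x = (\<Sum>z\<in>S. pmf p z * k z x * boltzmann \<beta> f z) / pt x" for x
    unfolding I_def integral_posterior_pmf[where k = k, OF fin k] pt_def[symmetric] S_def[symmetric]
    by (simp add: mult_ac)
  \<comment> \<open>The factor \<open>Z\<close> undoes the normalisation of the product
    distribution.\<close>
  have I_prod: "I x = Z * pt_prod x / pt x" for x
    using Z unfolding I_eq prod_eq by (simp add: mult_ac)

  \<comment> \<open>The weights \<open>pmf p z * k z x\<close> sum to \<open>pt x\<close>, so
    \<open>I x\<close> is a weighted average of values of the continuous function
    \<open>boltzmann \<beta> f\<close>.\<close>
  have "\<exists>y. boltzmann \<beta> f y = I x" if "pt x > 0" for x
  proof -
    have "continuous_on UNIV (boltzmann \<beta> f)"
      unfolding boltzmann_def by (intro continuous_intros f)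
    then show ?thesis
      using weighted_average_in_range[of "boltzmann \<beta> f" S "\<lambda>z. pmf p z * k z x"] that finS k
      unfolding I_eq pt_eq by (metis mult_nonneg_nonneg pmf_nonneg)
  qed
  then obtain xhat where xhat: "boltzmann \<beta> f (xhat x) = I x" if "pt x > 0" for x
    by metis
  have I_pos: "I x > 0" if "pt x > 0" for x
    using xhat[OF that] boltzmann_pos by metis
  have f_xhat: "f (xhat x) = - (1 / \<beta>) * ln (I x)" if "pt x > 0" for x
    using \<beta> unfolding xhat[OF that, symmetric] boltzmann_def by simp
  \<comment> \<open>\<open>I x\<close> is a value of the exponential, hence positive; the signs in
    \<open>I_prod\<close> then force \<open>pt_prod x\<close> to be positive.\<close>
  have prod_pos: "pt_prod x > 0" if "pt x > 0" for x
    using I_pos[OF that] Z that by (simp add: I_prod zero_less_divide_iff zero_less_mult_iff)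

  have k_at: "k z differentiable at x" for z x
    using k_diff by (simp add: differentiable_on_def)
  \<comment> \<open>Finite support turns both diffused densities into finite sums, which avoids
    differentiating under an integral.\<close>
  have pt_diff: "pt differentiable at x" for x
    unfolding pt_eq[abs_def] by (intro derivative_intros differentiable_sum finS ballI k_at)
  have prod_diff: "pt_prod differentiable at x" for x
    unfolding prod_eq[abs_def] divide_inverse
    by (intro differentiable_mult differentiable_const differentiable_sum finS ballI k_at)
  have ln_diff: "(\<lambda>y. ln (q y)) differentiable at x"
    if "q differentiable at x" "q x > 0" for q :: "'a \<Rightarrow> real" and x
    using that unfolding differentiable_def by (blast intro: has_derivative_ln)

  have "f (xhat x) = - (1 / \<beta>) * ln (I x) \<and>
      pt_prod x > 0 \<and>
      (\<lambda>y. ln (pt_prod y)) differentiable at x \<and>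
      (\<lambda>y. ln (pt y)) differentiable at x \<and>
      (\<lambda>y. f (xhat y)) differentiable at x \<and>
      score pt_prod x = score pt x - \<beta> *\<^sub>R gradient (\<lambda>y. f (xhat y)) x"
    if x: "pt x > 0" for x
  proof -
    have d1: "(\<lambda>y. ln (pt_prod y)) differentiable at x"
      and d2: "(\<lambda>y. ln (pt y)) differentiable at x"
      using ln_diff prod_diff pt_diff prod_pos x by auto
    obtain G1 G2 where G1: "GDERIV (\<lambda>y. ln (pt_prod y)) x :> G1"
      and G2: "GDERIV (\<lambda>y. ln (pt y)) x :> G2"
      using d1 d2 by (meson differentiable_imp_GDERIV)
    \<comment> \<open>Found by solving the claimed identity
      \<open>G1 = G2 - \<beta> *\<^sub>R ?G\<close> for \<open>?G\<close>.\<close>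
    let ?G = "(1 / \<beta>) *\<^sub>R (G2 - G1)"
    have "((\<lambda>y. (1 / \<beta>) * (ln (pt y) - ln (pt_prod y) - ln Z)) has_derivative
        (\<lambda>h. (1 / \<beta>) * (inner h G2 - inner h G1 - 0))) (at x)"
      using G1 G2 unfolding gderiv_def
      by (intro has_derivative_mult_right has_derivative_diff has_derivative_const)
    then have "GDERIV (\<lambda>y. (1 / \<beta>) * (ln (pt y) - ln (pt_prod y) - ln Z)) x :> ?G"
      unfolding gderiv_def by (simp add: inner_diff_right)
    \<comment> \<open>The closed form is known only where \<open>pt\<close> is positive. By
      continuity this holds on a neighbourhood of \<open>x\<close>, which is enough to transfer the
      derivative.\<close>
    moreover have "\<forall>\<^sub>F y in nhds x.
        (1 / \<beta>) * (ln (pt y) - ln (pt_prod y) - ln Z) = f (xhat y)"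
    proof -
      have "\<forall>\<^sub>F y in nhds x. pt y > 0"
        using differentiable_imp_continuous_within[OF pt_diff] x
        by (intro order_tendstoD(1)) (auto simp: continuous_at tendsto_at_iff_tendsto_nhds)
      then show ?thesis
      proof eventually_elim
        case (elim y)
        show ?case
          using prod_pos[OF elim] Z elim
          by (simp add: f_xhat I_prod ln_div ln_mult add_divide_distrib diff_divide_distrib)
      qed
    qed
    \<comment> \<open>The transfer rule wants agreement on a punctured neighbourhood and,
      separately, at \<open>x\<close> itself.\<close>
    then have ev: "\<forall>\<^sub>F y in at x.
        (1 / \<beta>) * (ln (pt y) - ln (pt_prod y) - ln Z) = f (xhat y)"
      "(1 / \<beta>) * (ln (pt x) - ln (pt_prod x) - ln Z) = f (xhat x)"
      by (auto simp: eventually_nhds_conv_at)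
    ultimately have G: "GDERIV (\<lambda>y. f (xhat y)) x :> ?G"
      unfolding gderiv_def by (rule has_derivative_transform_eventually) simp
    then have d3: "(\<lambda>y. f (xhat y)) differentiable at x"
      unfolding gderiv_def differentiable_def by blast
    have "score pt_prod x = score pt x - \<beta> *\<^sub>R gradient (\<lambda>y. f (xhat y)) x"
      using \<beta> unfolding score_def gradient_eqI[OF G] gradient_eqI[OF G1] gradient_eqI[OF G2]
      by simp
    then show ?thesis
      using f_xhat prod_pos x d1 d2 d3 by blast
  qed
  then show ?thesis
    unfolding I_def by blast
qed

lemma data_dist_eq_measure_pmf:
  assumes "\<exists>i\<in>{1..N}. snd (D i) = \<rho>"
  obtains p where "finite (set_pmf p)" "data_dist N D \<rho> = measure_pmf p"
proof
  let ?q = "map_pmf D (pmf_of_set {1..N})"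
  \<comment> \<open>An occurrence of \<open>\<rho>\<close> in the data makes \<open>{1..N}\<close>
    nonempty, so \<open>pmf_of_set\<close> is the uniform distribution, and gives the conditioning
    event positive probability.\<close>
  have q: "set_pmf ?q = D ` {1..N}"
    using assms by (auto simp: set_pmf_of_set)
  then have "set_pmf ?q \<inter> UNIV \<times> {\<rho>} \<noteq> {}"
    using assms by (force simp del: set_map_pmf simp: mem_Times_iff)
  from set_cond_pmf[OF this] q
  show "finite (set_pmf (map_pmf fst (cond_pmf ?q (UNIV \<times> {\<rho>}))))"
    by simp
qed (rule data_dist_def)

text \<open>Where \<open>pt x = 0\<close> neither the posterior nor the score makes sense, hence the
  restriction to \<open>pt x > 0\<close>. The differentiability conjuncts ensure that the gradients
  are genuine.\<close>

theorem theorem1: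
  fixes f :: "real ^ 'n \<Rightarrow> real"
    and D :: "nat \<Rightarrow> (real ^ 'n) \<times> real"
    and a :: "real ^ 'n \<Rightarrow> real \<Rightarrow> real ^ 'n"
    and b :: "real \<Rightarrow> real"
    and M :: "'w measure" and F :: "real \<Rightarrow> 'w measure"
    and B :: "real \<Rightarrow> 'w \<Rightarrow> real ^ 'n"
    and p0t :: "real ^ 'n \<Rightarrow> real ^ 'n \<Rightarrow> real"
    and \<rho> \<beta> T t :: real and N :: nat
  defines "p0 \<equiv> data_dist N D \<rho>"
  defines "pt \<equiv> diffused p0t p0"
    and "pt_prod \<equiv> diffused p0t (product_dist p0 \<beta> f)"
  assumes f: "f differentiable_on UNIV"
    and \<rho>: "0 < \<rho>" "\<rho> < 1"
    and data: "\<exists>i\<in>{1..N}. snd (D i) = \<rho>"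
    and B: "brownian_motion M F B"
    and t: "0 < t" "t \<le> T"
    and p0t: "transition_density M F B a b T t p0t"
    and p0t_diff: "\<And>x0. p0t x0 differentiable_on UNIV"
    and \<beta>: "\<beta> > 0"
  shows "\<exists>xhat :: real ^ 'n \<Rightarrow> real ^ 'n. \<forall>x. pt x > 0 \<longrightarrow>
    f (xhat x) = - (1 / \<beta>) * ln (\<integral>x0. boltzmann \<beta> f x0 \<partial>posterior p0t p0 x) \<and>
    pt_prod x > 0 \<and>
    (\<lambda>y. ln (pt_prod y)) differentiable at x \<and>
    (\<lambda>y. ln (pt y)) differentiable at x \<and>
    (\<lambda>y. f (xhat y)) differentiable at x \<and>
    score pt_prod x = score pt x - \<beta> *\<^sub>R gradient (\<lambda>y. f (xhat y)) x"
proof -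
  obtain p where p: "finite (set_pmf p)" "p0 = measure_pmf p"
    using data_dist_eq_measure_pmf[OF data] unfolding p0_def by metis
  have "\<And>z x. 0 \<le> p0t z x"
    using p0t unfolding transition_density_def by blast
  then show ?thesis
    unfolding pt_def pt_prod_def p(2)
    by (intro score_diffused_product_pmf p(1) p0t_diff \<beta>
        differentiable_imp_continuous_on f)
qed

end
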